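(* Let $F$ be an arbitrary field. There is no two-dimensional Poisson algebra over $F$ for which both the associative multiplication and the Lie multiplication are non-zero.
   Context: A Poisson algebra over a field $F$ is an $F$-vector space $P$ with two $F$-bilinear operations: a commutative associative multiplication $(x,y)\mapsto xy$ (not assumed to have an identity) and a Lie multiplication $(x,y)\mapsto[x,y]$ (alternating, $[x,x]=0$ for all $x$, and satisfying the Jacobi identity), such that $[xy,z]=x[y,z]+y[x,z]$ for all $x,y,z\in P$. No restriction on $\operatorname{char}(F)$ is imposed. *)

theory Defs
  imports Complex_Main
begin

text \<open>The underlying vector space is a whole type \<open>'p\<close> with scalar multiplication \<open>scale\<close>;
  \<open>Vector_Spaces.linear\<close> in each argument expresses bilinearity. The associative
  multiplication is not assumed to have an identity element.\<close>

locale poisson_algebra = vector_space scale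
  for scale :: "'f::field \<Rightarrow> 'p::ab_group_add \<Rightarrow> 'p" +
  fixes mult :: "'p \<Rightarrow> 'p \<Rightarrow> 'p"
    and lie :: "'p \<Rightarrow> 'p \<Rightarrow> 'p"
  assumes mult_linear_left: "\<And>y. Vector_Spaces.linear scale scale (\<lambda>x. mult x y)"
    and mult_linear_right: "\<And>x. Vector_Spaces.linear scale scale (\<lambda>y. mult x y)"
    and mult_commute: "\<And>x y. mult x y = mult y x"
    and mult_assoc: "\<And>x y z. mult (mult x y) z = mult x (mult y z)"
    and lie_linear_left: "\<And>y. Vector_Spaces.linear scale scale (\<lambda>x. lie x y)"
    and lie_linear_right: "\<And>x. Vector_Spaces.linear scale scale (\<lambda>y. lie x y)"
    and lie_alternating: "\<And>x. lie x x = 0"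
    and jacobi: "\<And>x y z. lie x (lie y z) + lie y (lie z x) + lie z (lie x y) = 0"
    and leibniz: "\<And>x y z. lie (mult x y) z = mult x (lie y z) + mult y (lie x z)"

end

theory Submission
  imports Defs
begin

text \<open>In a two-dimensional Lie algebra every bracket is a multiple of a single vector \<open>c\<close>. If
  \<open>c \<noteq> 0\<close>, then \<open>ad c\<close> does not vanish, and so after rescaling there is a basis \<open>h, c\<close> with
  \<open>[h,c] = c\<close>: the bracket is that of the non-abelian two-dimensional Lie algebra, in every
  characteristic (\<open>ex_affine_basis\<close>).

  The products of \<open>h\<close> and \<open>c\<close> are then forced to vanish (\<open>mult_eq_0_if_affine_basis\<close>). In this
  Lie algebra the centralizer of \<open>c\<close> is the line of \<open>c\<close>, and that of \<open>h\<close> is the line of \<open>h\<close>, so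
  the Leibniz rule gives \<open>cc = \<mu>c\<close>, then \<open>hc = \<nu>c\<close>, and \<open>hh = \<rho>h\<close>. The derivation \<open>[-,h]\<close> has
  eigenvalue \<open>-1\<close> on \<open>c\<close> but \<open>-2\<close> on \<open>cc\<close>, and these differ in every field; hence \<open>\<mu> = 0\<close>.
  Bracketing \<open>hh\<close> with \<open>c\<close> gives \<open>\<rho> = 2\<nu>\<close>, whereas associativity, in the form
  \<open>(hh)c = h(hc)\<close>, gives \<open>\<rho>\<nu> = \<nu>\<^sup>2\<close>; so \<open>2\<nu>\<^sup>2 = \<nu>\<^sup>2\<close> and \<open>\<nu> = \<rho> = 0\<close>. No step divides by an
  integer, which is why the characteristic does not matter.\<close>

context poisson_algebra
begin

lemmas lie_hom_left = module_hom_linearI[OF lie_linear_left]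
lemmas lie_hom_right = module_hom_linearI[OF lie_linear_right]
lemmas mult_hom_left = module_hom_linearI[OF mult_linear_left]
lemmas mult_hom_right = module_hom_linearI[OF mult_linear_right]

lemmas lie_simps =
  module_hom.add[OF lie_hom_left]
  module_hom.scale[OF lie_hom_left]
  module_hom.add[OF lie_hom_right]
  module_hom.scale[OF lie_hom_right]

lemmas mult_simps =
  module_hom.add[OF mult_hom_left]
  module_hom.scale[OF mult_hom_left]
  module_hom.add[OF mult_hom_right]
  module_hom.scale[OF mult_hom_right]

lemma lie_anticommute: "lie x y = - lie y x"
proof -
  have "lie (x + y) (x + y) = 0" by (rule lie_alternating)
  then have "lie x y + lie y x = 0"
    unfolding lie_simps(1,3) unfolding lie_alternating by (simp add: add.commute)
  then show ?thesis by (rule eq_neg_iff_add_eq_0[THEN iffD2])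
qed

lemma mult_eq_0_if_affine_basis:
  assumes span: "\<And>x. \<exists>s t. x = scale s h + scale t c"
    and hc: "lie h c = c" and c0: "c \<noteq> 0"
  shows "mult x y = 0"
proof -
  have ch: "lie c h = - c" using lie_anticommute[of c h] hc by simp
  have centralizer_c: "\<exists>t. z = scale t c" if z: "lie z c = 0" for z
  proof -
    obtain s t where st: "z = scale s h + scale t c" using span by blast
    have "scale s c = 0" using z by (simp add: st lie_simps hc lie_alternating)
    then show ?thesis using st c0 by auto
  qed
  have centralizer_h: "\<exists>s. z = scale s h" if z: "lie z h = 0" for z
  proof -
    obtain s t where st: "z = scale s h + scale t c" using span by blast
    have "scale t (- c) = 0" using z by (simp add: st lie_simps ch lie_alternating)
    then show ?thesis using st c0 by auto
  qed
  have mult_minus: "mult u (- v) = - mult u v" for u v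
    by (rule module_hom.neg[OF mult_hom_right])

  have cc: "mult c c = 0"
  proof -
    have "lie (mult c c) c = 0"
      by (simp add: leibniz lie_alternating module_hom.zero[OF mult_hom_right])
    then obtain \<mu> where \<mu>: "mult c c = scale \<mu> c" using centralizer_c by blast
    have "lie (mult c c) h = - mult c c + - mult c c"
      by (simp add: leibniz ch mult_minus)
    moreover have "lie (mult c c) h = - mult c c" by (simp add: \<mu> lie_simps ch)
    ultimately show ?thesis by simp
  qed

  have "lie (mult h c) c = 0"
    by (simp add: leibniz lie_alternating module_hom.zero[OF mult_hom_right] hc cc)
  then obtain \<nu> where \<nu>: "mult h c = scale \<nu> c" using centralizer_c by blast
  have "lie (mult h h) h = 0"
    by (simp add: leibniz lie_alternating module_hom.zero[OF mult_hom_right])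
  then obtain \<rho> where \<rho>: "mult h h = scale \<rho> h" using centralizer_h by blast
  have "scale \<rho> c = scale (\<nu> + \<nu>) c"
    using leibniz[of h h c] unfolding scale_left_distrib by (simp add: \<rho> \<nu> hc lie_simps)
  then have rn: "\<rho> = \<nu> + \<nu>" using c0 by simp
  have "scale (\<rho> * \<nu>) c = scale (\<nu> * \<nu>) c"
    using mult_assoc[of h h c] by (simp add: \<rho> \<nu> mult_simps)
  then have "\<nu> * \<nu> + \<nu> * \<nu> = \<nu> * \<nu>" using c0 rn by (simp add: distrib_right[symmetric])
  then have n0: "\<nu> = 0" unfolding add_cancel_left_left by simp

  have hc0: "mult h c = 0" "mult c h = 0" "mult h h = 0"
    using \<nu> \<rho> rn n0 mult_commute[of c h] by simp_all
  obtain s t where "x = scale s h + scale t c" using span by blast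
  moreover obtain s' t' where "y = scale s' h + scale t' c" using span by blast
  ultimately show ?thesis by (simp add: mult_simps cc hc0)
qed

text \<open>With \<open>c = [a,b]\<close> one has \<open>[a,c] = \<beta>c\<close>, so \<open>h = \<beta>\<^sup>-\<^sup>1a\<close> satisfies \<open>[h,c] = c\<close>; and as \<open>b\<close>
  occurs in \<open>c\<close>, it can be exchanged for \<open>c\<close>.\<close>

lemma ex_affine_basis_if_coeff_nonzero:
  assumes span: "\<And>x. \<exists>s t. x = scale s a + scale t b"
    and ab: "lie a b = scale \<alpha> a + scale \<beta> b" and "\<beta> \<noteq> 0"
  shows "\<exists>h. lie h (lie a b) = lie a b \<and>
    (\<forall>x. \<exists>s t. x = scale s h + scale t (lie a b))"
proof -
  let ?h = "scale (inverse \<beta>) a"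
  have "lie a (scale \<alpha> a + scale \<beta> b) = scale \<beta> (lie a b)"
    by (simp add: lie_simps lie_alternating)
  then have "lie a (lie a b) = scale \<beta> (lie a b)"
    by (simp only: ab[symmetric])
  then have "lie ?h (lie a b) = lie a b" using \<open>\<beta> \<noteq> 0\<close> by (simp add: lie_simps)
  moreover have "\<exists>s t. x = scale s ?h + scale t (lie a b)" for x
  proof -
    obtain s t where x: "x = scale s a + scale t b" using span by blast
    have "s = (s * \<beta> - t * \<alpha>) * inverse \<beta> + t * inverse \<beta> * \<alpha>"
      using \<open>\<beta> \<noteq> 0\<close> by (simp add: field_simps)
    then have "scale s a = scale ((s * \<beta> - t * \<alpha>) * inverse \<beta>) a
        + scale (t * inverse \<beta> * \<alpha>) a"
      by (metis scale_left_distrib)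
    then have "x = scale (s * \<beta> - t * \<alpha>) ?h + scale (t * inverse \<beta>) (lie a b)"
      using \<open>\<beta> \<noteq> 0\<close> by (simp add: x ab scale_right_distrib)
    then show ?thesis by blast
  qed
  ultimately show ?thesis by blast
qed

text \<open>At least one of the two coefficients of \<open>[a,b]\<close> is nonzero, and exchanging \<open>a\<close> and \<open>b\<close>
  exchanges their roles, up to a sign.\<close>

lemma ex_affine_basis:
  assumes span: "\<And>x. \<exists>s t. x = scale s a + scale t b" and ne: "lie a b \<noteq> 0"
  shows "\<exists>h c. c \<noteq> 0 \<and> lie h c = c \<and> (\<forall>x. \<exists>s t. x = scale s h + scale t c)"
proof -
  obtain \<alpha> \<beta> where ab: "lie a b = scale \<alpha> a + scale \<beta> b" using span by blast
  show ?thesis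
  proof (cases "\<beta> = 0")
    case False
    show ?thesis using ex_affine_basis_if_coeff_nonzero[OF span ab False] ne by blast
  next
    case True
    then have "- \<alpha> \<noteq> 0" using ab ne by auto
    have span': "\<exists>s t. x = scale s b + scale t a" for x
      using span[of x] by (metis add.commute)
    have ba: "lie b a = scale (- \<beta>) b + scale (- \<alpha>) a"
      using lie_anticommute[of b a] ab by simp
    have "lie b a \<noteq> 0" using lie_anticommute[of a b] ne by auto
    then show ?thesis
      using ex_affine_basis_if_coeff_nonzero[OF span' ba \<open>- \<alpha> \<noteq> 0\<close>] by blast
  qed
qed

lemma ex_spanning_pair:
  assumes "dim UNIV = 2"
  shows "\<exists>a b. \<forall>x. \<exists>s t. x = scale s a + scale t b"
proof -
  obtain B where B: "UNIV \<subseteq> span B" "card B = dim UNIV"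
    using basis_exists[of UNIV] by blast
  then obtain a b where "B = {a, b}" using assms by (auto simp: card_2_iff)
  then have "x \<in> span {a, b}" for x using B by blast
  then have "\<exists>s t. x - scale s a = scale t b" for x
    by (auto simp: span_insert span_singleton)
  then show ?thesis by (metis diff_eq_eq add.commute)
qed

lemma mult_or_lie_eq_0_if_dim_2:
  assumes "dim UNIV = 2"
  shows "(\<forall>x y. mult x y = 0) \<or> (\<forall>x y. lie x y = 0)"
proof -
  obtain a b where ab: "\<And>x. \<exists>s t. x = scale s a + scale t b"
    using ex_spanning_pair[OF assms] by blast
  show ?thesis
  proof (cases "lie a b = 0")
    case True
    then have "lie b a = 0" using lie_anticommute[of b a] by simp
    have "lie x y = 0" for x y
    proof -
      obtain s t where "x = scale s a + scale t b" using ab by blast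
      moreover obtain s' t' where "y = scale s' a + scale t' b" using ab by blast
      ultimately show ?thesis
        by (simp add: lie_simps lie_alternating True \<open>lie b a = 0\<close>)
    qed
    then show ?thesis by blast
  next
    case False
    then obtain h c where "c \<noteq> 0" "lie h c = c" "\<And>x. \<exists>s t. x = scale s h + scale t c"
      using ex_affine_basis[OF ab] by blast
    then show ?thesis using mult_eq_0_if_affine_basis by blast
  qed
qed

end

theorem corollary4p2:
  shows "\<not> (\<exists>(scale :: 'f::field \<Rightarrow> 'p::ab_group_add \<Rightarrow> 'p) mult lie.
           poisson_algebra scale mult lie \<and>
           vector_space.dim scale (UNIV :: 'p set) = 2 \<and>
           (\<exists>x y. mult x y \<noteq> 0) \<and>
           (\<exists>x y. lie x y \<noteq> 0))"
  using poisson_algebra.mult_or_lie_eq_0_if_dim_2 by blast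

end
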